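(* For every odd prime $p$, the number of edges of $G_p$ is $$|E(G_p)|=\frac{(p^2-1)(2p^3+p^2-2p-2)}{2}.$$
   Context: For $n\ge2$, $\mathbb{L}_n=\{a+bi+cj+dk: a,b,c,d\in\mathbb{Z}/n\mathbb{Z}\}$ is the ring of Lipschitz quaternions modulo $n$, with the usual relations $i^2=j^2=k^2=-1$, $ij=k=-ji$, $jk=i=-kj$, $ki=j=-ik$ taken modulo $n$. A nonzero element $x$ of a ring is a zero divisor if $xy=0$ or $yx=0$ for some nonzero $y$. $G_n=\Gamma(\mathbb{L}_n)$ is the simple undirected graph whose vertices are the nonzero zero divisors of $\mathbb{L}_n$, distinct $x,y$ being adjacent iff $xy=0$ or $yx=0$. (For odd primes $p$, $\mathbb{L}_p\cong M_2(\mathbb{F}_p)$.) *)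

theory Defs
  imports Complex_Main "HOL-Number_Theory.Residues"
begin

text \<open>A quadruple \<open>(a, b, c, d)\<close> stands for \<open>a + b i + c j + d k\<close>; the product is the
  bilinear extension of \<open>i\<^sup>2 = j\<^sup>2 = k\<^sup>2 = -1\<close>, \<open>ij = k = -ji\<close>, \<open>jk = i = -kj\<close>, \<open>ki = j = -ik\<close>.\<close>

definition quaternion_ring ::
    "('a, 'm) ring_scheme \<Rightarrow> ('a \<times> 'a \<times> 'a \<times> 'a) ring" where
  "quaternion_ring R =
    \<lparr>carrier = carrier R \<times> carrier R \<times> carrier R \<times> carrier R,
     monoid.mult = \<lambda>(a, b, c, d) (a', b', c', d').
       (a \<otimes>\<^bsub>R\<^esub> a' \<ominus>\<^bsub>R\<^esub> b \<otimes>\<^bsub>R\<^esub> b' \<ominus>\<^bsub>R\<^esub> c \<otimes>\<^bsub>R\<^esub> c' \<ominus>\<^bsub>R\<^esub> d \<otimes>\<^bsub>R\<^esub> d',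
        a \<otimes>\<^bsub>R\<^esub> b' \<oplus>\<^bsub>R\<^esub> b \<otimes>\<^bsub>R\<^esub> a' \<oplus>\<^bsub>R\<^esub> c \<otimes>\<^bsub>R\<^esub> d' \<ominus>\<^bsub>R\<^esub> d \<otimes>\<^bsub>R\<^esub> c',
        a \<otimes>\<^bsub>R\<^esub> c' \<ominus>\<^bsub>R\<^esub> b \<otimes>\<^bsub>R\<^esub> d' \<oplus>\<^bsub>R\<^esub> c \<otimes>\<^bsub>R\<^esub> a' \<oplus>\<^bsub>R\<^esub> d \<otimes>\<^bsub>R\<^esub> b',
        a \<otimes>\<^bsub>R\<^esub> d' \<oplus>\<^bsub>R\<^esub> b \<otimes>\<^bsub>R\<^esub> c' \<ominus>\<^bsub>R\<^esub> c \<otimes>\<^bsub>R\<^esub> b' \<oplus>\<^bsub>R\<^esub> d \<otimes>\<^bsub>R\<^esub> a'),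
     one = (\<one>\<^bsub>R\<^esub>, \<zero>\<^bsub>R\<^esub>, \<zero>\<^bsub>R\<^esub>, \<zero>\<^bsub>R\<^esub>),
     zero = (\<zero>\<^bsub>R\<^esub>, \<zero>\<^bsub>R\<^esub>, \<zero>\<^bsub>R\<^esub>, \<zero>\<^bsub>R\<^esub>),
     add = \<lambda>(a, b, c, d) (a', b', c', d').
       (a \<oplus>\<^bsub>R\<^esub> a', b \<oplus>\<^bsub>R\<^esub> b', c \<oplus>\<^bsub>R\<^esub> c', d \<oplus>\<^bsub>R\<^esub> d')\<rparr>"

definition lipschitz_ring :: "nat \<Rightarrow> (int \<times> int \<times> int \<times> int) ring" where
  "lipschitz_ring n = quaternion_ring (residue_ring (int n))"

definition nonzero_zero_divisors :: "('a, 'm) ring_scheme \<Rightarrow> 'a set" where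
  "nonzero_zero_divisors R =
    {x \<in> carrier R - {\<zero>\<^bsub>R\<^esub>}. \<exists>y \<in> carrier R - {\<zero>\<^bsub>R\<^esub>}. x \<otimes>\<^bsub>R\<^esub> y = \<zero>\<^bsub>R\<^esub> \<or> y \<otimes>\<^bsub>R\<^esub> x = \<zero>\<^bsub>R\<^esub>}"

text \<open>A simple undirected graph is a pair of a vertex set and a set of two-element edges.\<close>

definition zero_divisor_graph :: "('a, 'm) ring_scheme \<Rightarrow> 'a set \<times> 'a set set" where
  "zero_divisor_graph R =
    (nonzero_zero_divisors R,
     {{x, y} | x y. x \<in> nonzero_zero_divisors R \<and> y \<in> nonzero_zero_divisors R \<and> x \<noteq> y \<and>
        (x \<otimes>\<^bsub>R\<^esub> y = \<zero>\<^bsub>R\<^esub> \<or> y \<otimes>\<^bsub>R\<^esub> x = \<zero>\<^bsub>R\<^esub>)})"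

definition graph_edges :: "'v set \<times> 'v set set \<Rightarrow> 'v set set" where
  "graph_edges G = snd G"

lemma (in cring) quaternion_ring_is_ring: "ring (quaternion_ring R)"
proof (rule ringI)
  show "abelian_group (quaternion_ring R)"
  proof (rule abelian_groupI)
    fix x assume "x \<in> carrier (quaternion_ring R)"
    then obtain a b c d where "x = (a, b, c, d)"
      "a \<in> carrier R" "b \<in> carrier R" "c \<in> carrier R" "d \<in> carrier R"
      by (auto simp: quaternion_ring_def)
    then show "\<exists>y\<in>carrier (quaternion_ring R). y \<oplus>\<^bsub>quaternion_ring R\<^esub> x = \<zero>\<^bsub>quaternion_ring R\<^esub>"
      by (intro bexI[of _ "(\<ominus> a, \<ominus> b, \<ominus> c, \<ominus> d)"]) (auto simp: quaternion_ring_def l_neg)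
  qed (auto simp: quaternion_ring_def a_ac)
  show "monoid (quaternion_ring R)"
    by (rule monoidI)
       (auto simp: quaternion_ring_def minus_eq l_distr r_distr minus_add l_minus r_minus
          m_assoc a_ac)
qed (auto simp: quaternion_ring_def minus_eq l_distr r_distr minus_add a_ac)

lemma (in cring) quaternion_ring_units:
  defines "Q \<equiv> quaternion_ring R"
    and "e \<equiv> (\<one>, \<zero>, \<zero>, \<zero>)" and "i \<equiv> (\<zero>, \<one>, \<zero>, \<zero>)"
    and "j \<equiv> (\<zero>, \<zero>, \<one>, \<zero>)" and "k \<equiv> (\<zero>, \<zero>, \<zero>, \<one>)"
  shows "i \<otimes>\<^bsub>Q\<^esub> i = \<ominus>\<^bsub>Q\<^esub> e" "j \<otimes>\<^bsub>Q\<^esub> j = \<ominus>\<^bsub>Q\<^esub> e" "k \<otimes>\<^bsub>Q\<^esub> k = \<ominus>\<^bsub>Q\<^esub> e"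
    "i \<otimes>\<^bsub>Q\<^esub> j = k" "j \<otimes>\<^bsub>Q\<^esub> i = \<ominus>\<^bsub>Q\<^esub> k" "j \<otimes>\<^bsub>Q\<^esub> k = i" "k \<otimes>\<^bsub>Q\<^esub> j = \<ominus>\<^bsub>Q\<^esub> i"
    "k \<otimes>\<^bsub>Q\<^esub> i = j" "i \<otimes>\<^bsub>Q\<^esub> k = \<ominus>\<^bsub>Q\<^esub> j"
proof -
  interpret Q: ring Q unfolding Q_def by (rule quaternion_ring_is_ring)
  have neg: "\<ominus>\<^bsub>Q\<^esub> (a, b, c, d) = (\<ominus> a, \<ominus> b, \<ominus> c, \<ominus> d)"
    if "a \<in> carrier R" "b \<in> carrier R" "c \<in> carrier R" "d \<in> carrier R" for a b c d
    by (rule Q.minus_equality) (use that in \<open>auto simp: Q_def quaternion_ring_def l_neg\<close>)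
  show "i \<otimes>\<^bsub>Q\<^esub> i = \<ominus>\<^bsub>Q\<^esub> e" "j \<otimes>\<^bsub>Q\<^esub> j = \<ominus>\<^bsub>Q\<^esub> e" "k \<otimes>\<^bsub>Q\<^esub> k = \<ominus>\<^bsub>Q\<^esub> e"
    "i \<otimes>\<^bsub>Q\<^esub> j = k" "j \<otimes>\<^bsub>Q\<^esub> i = \<ominus>\<^bsub>Q\<^esub> k" "j \<otimes>\<^bsub>Q\<^esub> k = i" "k \<otimes>\<^bsub>Q\<^esub> j = \<ominus>\<^bsub>Q\<^esub> i"
    "k \<otimes>\<^bsub>Q\<^esub> i = j" "i \<otimes>\<^bsub>Q\<^esub> k = \<ominus>\<^bsub>Q\<^esub> j"
    unfolding e_def i_def j_def k_def
    by (simp_all add: neg) (simp_all add: Q_def quaternion_ring_def minus_eq)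
qed

end

theory Submission
  imports Defs
begin

text \<open>
  Over a finite field of odd characteristic, \<open>-1\<close> is a sum of two squares
  (\<open>ex_sum_two_squares_eq_minus_one\<close>), and any solution of \<open>u\<^sup>2 + v\<^sup>2 = -1\<close> identifies the
  quaternions with the two-by-two matrices (\<open>quaternion_matrix_mult\<close>,
  \<open>inj_on_quaternion_matrix\<close>). The edges can therefore be counted in the matrix ring over the
  field with \<open>q\<close> elements.

  There the zero divisors are the nonzero singular matrices; their number is
  \<open>(q\<^sup>2 - 1) (q + 1)\<close>. The kernel of such a matrix \<open>x\<close> is a line. Since \<open>xy = 0\<close> means that
  the columns of \<open>y\<close> lie in this line, there are \<open>q\<^sup>2\<close> solutions \<open>y\<close>; by transposition
  \<open>yx = 0\<close> has \<open>q\<^sup>2\<close> solutions as well, and \<open>q\<close> matrices satisfy both equations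
  (\<open>card_two_sided_annihilator\<close>). Leaving out \<open>0\<close>, the union of the two annihilators has
  \<open>2q\<^sup>2 - q - 1\<close> elements. They are the neighbours of \<open>x\<close>, and \<open>x\<close> itself if \<open>x\<^sup>2 = 0\<close>,
  which happens for \<open>q\<^sup>2 - 1\<close> nonzero matrices. Summing the degrees gives
  \<open>2 |E| = (q\<^sup>2 - 1) (q + 1) (2q\<^sup>2 - q - 1) - (q\<^sup>2 - 1)
           = (q\<^sup>2 - 1) (2q\<^sup>3 + q\<^sup>2 - 2q - 2)\<close>.
\<close>

section \<open>Normalizing ring identities\<close>

context cring begin

lemma minus_move:
  assumes "a \<in> carrier R" "b \<in> carrier R" "c \<in> carrier R"
  shows "a \<ominus> b = c \<longleftrightarrow> a = c \<oplus> b" "c = a \<ominus> b \<longleftrightarrow> c \<oplus> b = a"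
proof -
  have "a \<ominus> b = c" if "a = c \<oplus> b"
    using assms by (simp add: that minus_eq a_assoc r_neg)
  moreover have "a = c \<oplus> b" if "c = a \<ominus> b"
    using assms by (simp add: that minus_eq a_assoc l_neg)
  ultimately show "a \<ominus> b = c \<longleftrightarrow> a = c \<oplus> b" "c = a \<ominus> b \<longleftrightarrow> c \<oplus> b = a"
    by auto
qed

lemma minus_collect:
  assumes "a \<in> carrier R" "b \<in> carrier R" "c \<in> carrier R"
  shows "a \<oplus> (b \<ominus> c) = (a \<oplus> b) \<ominus> c" "(a \<ominus> b) \<oplus> c = (a \<oplus> c) \<ominus> b"
    "a \<ominus> (b \<ominus> c) = (a \<oplus> c) \<ominus> b" "(a \<ominus> b) \<ominus> c = a \<ominus> (b \<oplus> c)"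
    "(a \<ominus> b) \<otimes> c = a \<otimes> c \<ominus> b \<otimes> c" "c \<otimes> (a \<ominus> b) = c \<otimes> a \<ominus> c \<otimes> b"
  using assms by (simp_all add: minus_eq minus_add a_ac l_distr r_distr l_minus r_minus)

lemma uminus_eq_minus: "a \<in> carrier R \<Longrightarrow> \<ominus> a = \<zero> \<ominus> a"
  by (simp add: minus_eq)

text \<open>Rewriting with these equations brings every term into the form \<open>P \<ominus> N\<close>, where neither
  \<open>P\<close> nor \<open>N\<close> contains a minus sign, and an equation \<open>P \<ominus> N = P' \<ominus> N'\<close> into
  \<open>P \<oplus> N' = P' \<oplus> N\<close>. Each identity of commutative rings thereby turns into an identity of
  commutative semirings, which associativity, commutativity and distributivity decide: no
  cancellation of opposite terms is ever required.\<close>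

lemmas ring_normalize = uminus_eq_minus minus_collect minus_move a_ac m_ac l_distr r_distr

end

section \<open>Quaternions as matrices\<close>

text \<open>The quadruple \<open>(a, b, c, d)\<close> is the matrix with rows \<open>(a, b)\<close> and \<open>(c, d)\<close>.\<close>

definition mat2_ring :: "('a, 'm) ring_scheme \<Rightarrow> ('a \<times> 'a \<times> 'a \<times> 'a) ring" where
  "mat2_ring R =
    \<lparr>carrier = carrier R \<times> carrier R \<times> carrier R \<times> carrier R,
     monoid.mult = \<lambda>(a, b, c, d) (a', b', c', d').
       (a \<otimes>\<^bsub>R\<^esub> a' \<oplus>\<^bsub>R\<^esub> b \<otimes>\<^bsub>R\<^esub> c', a \<otimes>\<^bsub>R\<^esub> b' \<oplus>\<^bsub>R\<^esub> b \<otimes>\<^bsub>R\<^esub> d',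
        c \<otimes>\<^bsub>R\<^esub> a' \<oplus>\<^bsub>R\<^esub> d \<otimes>\<^bsub>R\<^esub> c', c \<otimes>\<^bsub>R\<^esub> b' \<oplus>\<^bsub>R\<^esub> d \<otimes>\<^bsub>R\<^esub> d'),
     one = (\<one>\<^bsub>R\<^esub>, \<zero>\<^bsub>R\<^esub>, \<zero>\<^bsub>R\<^esub>, \<one>\<^bsub>R\<^esub>),
     zero = (\<zero>\<^bsub>R\<^esub>, \<zero>\<^bsub>R\<^esub>, \<zero>\<^bsub>R\<^esub>, \<zero>\<^bsub>R\<^esub>),
     add = \<lambda>(a, b, c, d) (a', b', c', d').
       (a \<oplus>\<^bsub>R\<^esub> a', b \<oplus>\<^bsub>R\<^esub> b', c \<oplus>\<^bsub>R\<^esub> c', d \<oplus>\<^bsub>R\<^esub> d')\<rparr>"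

text \<open>If \<open>u\<^sup>2 + v\<^sup>2 = -1\<close>, then the matrices with rows \<open>(u, v)\<close>, \<open>(v, -u)\<close> and
  \<open>(0, -1)\<close>, \<open>(1, 0)\<close> square to \<open>-1\<close> and anticommute, and their product has rows
  \<open>(v, -u)\<close>, \<open>(-u, -v)\<close>. They serve as the images of \<open>i\<close>, \<open>j\<close> and \<open>k\<close>.\<close>

definition quaternion_matrix ::
    "('a, 'm) ring_scheme \<Rightarrow> 'a \<Rightarrow> 'a \<Rightarrow> 'a \<times> 'a \<times> 'a \<times> 'a \<Rightarrow> 'a \<times> 'a \<times> 'a \<times> 'a" where
  "quaternion_matrix R u v = (\<lambda>(a, b, c, d).
     (a \<oplus>\<^bsub>R\<^esub> (b \<otimes>\<^bsub>R\<^esub> u \<oplus>\<^bsub>R\<^esub> d \<otimes>\<^bsub>R\<^esub> v), (b \<otimes>\<^bsub>R\<^esub> v \<ominus>\<^bsub>R\<^esub> d \<otimes>\<^bsub>R\<^esub> u) \<ominus>\<^bsub>R\<^esub> c,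
      (b \<otimes>\<^bsub>R\<^esub> v \<ominus>\<^bsub>R\<^esub> d \<otimes>\<^bsub>R\<^esub> u) \<oplus>\<^bsub>R\<^esub> c, a \<ominus>\<^bsub>R\<^esub> (b \<otimes>\<^bsub>R\<^esub> u \<oplus>\<^bsub>R\<^esub> d \<otimes>\<^bsub>R\<^esub> v)))"

text \<open>The entries of both sides are polynomials in \<open>u\<close>, \<open>v\<close> and the coordinates that agree
  modulo \<open>u\<^sup>2 + v\<^sup>2 + 1\<close>, so it is enough to eliminate \<open>v\<^sup>2\<close> and compare.\<close>

lemma (in cring) quaternion_matrix_mult:
  assumes uv: "u \<in> carrier R" "v \<in> carrier R" "v \<otimes> v = \<ominus> \<one> \<ominus> u \<otimes> u"
    and "x \<in> carrier (quaternion_ring R)" "y \<in> carrier (quaternion_ring R)"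
  shows "quaternion_matrix R u v (x \<otimes>\<^bsub>quaternion_ring R\<^esub> y) =
    quaternion_matrix R u v x \<otimes>\<^bsub>mat2_ring R\<^esub> quaternion_matrix R u v y"
proof -
  have vv: "v \<otimes> (v \<otimes> z) = \<ominus> z \<ominus> u \<otimes> (u \<otimes> z)" if "z \<in> carrier R" for z
  proof -
    have "v \<otimes> (v \<otimes> z) = (v \<otimes> v) \<otimes> z" using that uv(1,2) by (simp add: m_assoc)
    also have "\<dots> = \<ominus> z \<ominus> u \<otimes> (u \<otimes> z)"
      unfolding uv(3) using that uv(1,2) by (simp add: ring_normalize)
    finally show ?thesis .
  qed
  obtain a b c d a' b' c' d' where
    [simp]: "x = (a, b, c, d)" "y = (a', b', c', d')" and
    "a \<in> carrier R" "b \<in> carrier R" "c \<in> carrier R" "d \<in> carrier R"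
    "a' \<in> carrier R" "b' \<in> carrier R" "c' \<in> carrier R" "d' \<in> carrier R"
    using assms(4,5) by (auto simp: quaternion_ring_def)
  then show ?thesis
    using uv(1,2)
    by (simp add: quaternion_matrix_def mat2_ring_def quaternion_ring_def uv(3) vv ring_normalize)
qed

context domain begin

lemma eq_if_sum_and_difference_eq:
  assumes "\<one> \<oplus> \<one> \<noteq> \<zero>" "a \<in> carrier R" "s \<in> carrier R" "a' \<in> carrier R" "s' \<in> carrier R"
    and "a \<oplus> s = a' \<oplus> s'" "a \<ominus> s = a' \<ominus> s'"
  shows "a = a' \<and> s = s'"
proof -
  have dbl: "(\<one> \<oplus> \<one>) \<otimes> z = (z \<oplus> w) \<oplus> (z \<ominus> w)" if "z \<in> carrier R" "w \<in> carrier R" for z w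
    using that by (simp add: ring_normalize)
  have "(\<one> \<oplus> \<one>) \<otimes> a = (\<one> \<oplus> \<one>) \<otimes> a'"
    using dbl[of a s] dbl[of a' s'] assms by simp
  then have "a = a'" using assms by (simp add: m_lcancel del: l_distr)
  then show ?thesis using assms by simp
qed

text \<open>Sum and difference of the diagonal entries determine \<open>a\<close> and \<open>s = bu + dv\<close>, those of the
  other two entries determine \<open>c\<close> and \<open>t = bv - du\<close>; this is where \<open>2 \<noteq> 0\<close> enters. The
  linear map from \<open>(b, d)\<close> to \<open>(s, t)\<close> has determinant \<open>- (u\<^sup>2 + v\<^sup>2) = 1\<close>, and its inverse
  is \<open>b = - (us + vt)\<close>, \<open>d = - (vs - ut)\<close>.\<close>

lemma inj_on_quaternion_matrix:
  assumes two: "\<one> \<oplus> \<one> \<noteq> \<zero>"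
    and uv: "u \<in> carrier R" "v \<in> carrier R" "v \<otimes> v = \<ominus> \<one> \<ominus> u \<otimes> u"
  shows "inj_on (quaternion_matrix R u v) (carrier (quaternion_ring R))"
proof (rule inj_onI)
  fix x y
  assume xy: "x \<in> carrier (quaternion_ring R)" "y \<in> carrier (quaternion_ring R)"
    and eq: "quaternion_matrix R u v x = quaternion_matrix R u v y"
  obtain a b c d a' b' c' d' where
    x: "x = (a, b, c, d)" and y: "y = (a', b', c', d')" and
    K: "a \<in> carrier R" "b \<in> carrier R" "c \<in> carrier R" "d \<in> carrier R"
    "a' \<in> carrier R" "b' \<in> carrier R" "c' \<in> carrier R" "d' \<in> carrier R"
    using xy by (auto simp: quaternion_ring_def)
  have s: "a = a' \<and> b \<otimes> u \<oplus> d \<otimes> v = b' \<otimes> u \<oplus> d' \<otimes> v"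
    using eq K uv(1,2) unfolding x y quaternion_matrix_def
    by (intro eq_if_sum_and_difference_eq two) auto
  have t: "b \<otimes> v \<ominus> d \<otimes> u = b' \<otimes> v \<ominus> d' \<otimes> u \<and> c = c'"
    using eq K uv(1,2) unfolding x y quaternion_matrix_def
    by (intro eq_if_sum_and_difference_eq two) auto
  have b: "z = \<ominus> (u \<otimes> (z \<otimes> u \<oplus> w \<otimes> v) \<oplus> v \<otimes> (z \<otimes> v \<ominus> w \<otimes> u))"
    and d: "w = \<ominus> (v \<otimes> (z \<otimes> u \<oplus> w \<otimes> v) \<ominus> u \<otimes> (z \<otimes> v \<ominus> w \<otimes> u))"
    if "z \<in> carrier R" "w \<in> carrier R" for z w
  proof -
    have "u \<otimes> (z \<otimes> u \<oplus> w \<otimes> v) \<oplus> v \<otimes> (z \<otimes> v \<ominus> w \<otimes> u) = z \<otimes> (u \<otimes> u \<oplus> v \<otimes> v)"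
      "v \<otimes> (z \<otimes> u \<oplus> w \<otimes> v) \<ominus> u \<otimes> (z \<otimes> v \<ominus> w \<otimes> u) = w \<otimes> (u \<otimes> u \<oplus> v \<otimes> v)"
      using that uv(1,2) by (simp_all add: ring_normalize)
    moreover have "u \<otimes> u \<oplus> v \<otimes> v = \<ominus> \<one>"
      unfolding uv(3) using uv(1,2) by (simp add: ring_normalize)
    ultimately show "z = \<ominus> (u \<otimes> (z \<otimes> u \<oplus> w \<otimes> v) \<oplus> v \<otimes> (z \<otimes> v \<ominus> w \<otimes> u))"
      "w = \<ominus> (v \<otimes> (z \<otimes> u \<oplus> w \<otimes> v) \<ominus> u \<otimes> (z \<otimes> v \<ominus> w \<otimes> u))"
      using that by (simp_all add: r_minus)
  qed
  have "b = b'" "d = d'"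
    using b[of b d] b[of b' d'] d[of b d] d[of d' d'] d[of b' d'] s t K by simp_all
  then show "x = y" using s t by (simp add: x y)
qed

end

text \<open>Every fibre of squaring has at most two elements and the fibre of \<open>0\<close> has one, so more
  than half of the field consists of squares. By the pigeonhole principle the squares meet
  their image under the injection \<open>s \<mapsto> -1 - s\<close>.\<close>

lemma (in field) ex_sum_two_squares_eq_minus_one:
  assumes fin: "finite (carrier R)"
  shows "\<exists>u\<in>carrier R. \<exists>v\<in>carrier R. v \<otimes> v = \<ominus> \<one> \<ominus> u \<otimes> u"
proof -
  let ?K = "carrier R"
  define S where "S = (\<lambda>x. x \<otimes> x) ` ?K"
  define T where "T = (\<lambda>s. \<ominus> \<one> \<ominus> s) ` S"
  have SK: "S \<subseteq> ?K" and TK: "T \<subseteq> ?K" by (auto simp: S_def T_def)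
  have finS: "finite S" using fin by (simp add: S_def)
  have fib: "card {x \<in> ?K. x \<otimes> x = s} \<le> 2" if s: "s \<in> S" for s
  proof -
    obtain y where y: "y \<in> ?K" "s = y \<otimes> y" using s by (auto simp: S_def)
    have "x = y \<or> x = \<ominus> y" if x: "x \<in> ?K" "x \<otimes> x = s" for x
    proof -
      have "(x \<ominus> y) \<otimes> (x \<oplus> y) = x \<otimes> x \<ominus> y \<otimes> y" using x(1) y(1) by (simp add: ring_normalize)
      also have "\<dots> = \<zero>" using x y by (simp add: minus_eq r_neg)
      finally have "x \<ominus> y = \<zero> \<or> x \<oplus> y = \<zero>"
        by (rule integral) (use x(1) y(1) in auto)
      then show ?thesis using x y minus_equality[of x y] by (auto simp: minus_move)
    qed
    then have "{x \<in> ?K. x \<otimes> x = s} \<subseteq> {y, \<ominus> y}" by auto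
    then show ?thesis
      by (rule order.trans[OF card_mono[rotated]]) (auto simp: card_insert_if)
  qed
  have zS: "\<zero> \<in> S" by (auto simp: S_def intro!: image_eqI[of _ _ \<zero>])
  have "{x \<in> ?K. x \<otimes> x = \<zero>} = {\<zero>}" using integral by auto
  then have fib0: "card {x \<in> ?K. x \<otimes> x = \<zero>} = 1" by simp
  have "card ?K = (\<Sum>s\<in>S. card {x \<in> ?K. x \<otimes> x = s})"
    using sum.group[OF fin finS, of "\<lambda>x. x \<otimes> x" "\<lambda>_. 1::nat"] by (auto simp: S_def)
  also have "\<dots> = 1 + (\<Sum>s\<in>S - {\<zero>}. card {x \<in> ?K. x \<otimes> x = s})"
    by (simp only: sum.remove[OF finS zS] fib0)
  also have "\<dots> \<le> 1 + (\<Sum>s\<in>S - {\<zero>}. 2)" using fib by (intro add_left_mono sum_mono) auto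
  also have "\<dots> < 2 * card S"
    using card_Diff_singleton[OF zS] card_gt_0_iff[of S] zS finS by auto
  finally have lt: "card ?K < 2 * card S" .
  have "card T = card S"
    unfolding T_def
  proof (rule card_image, rule inj_onI)
    fix s t assume st: "s \<in> S" "t \<in> S" "\<ominus> \<one> \<ominus> s = \<ominus> \<one> \<ominus> t"
    moreover have "r = \<ominus> \<one> \<ominus> (\<ominus> \<one> \<ominus> r)" if "r \<in> ?K" for r using that by (simp add: ring_normalize)
    ultimately show "s = t" using SK by (metis subsetD)
  qed
  have "S \<inter> T \<noteq> {}"
  proof
    assume "S \<inter> T = {}"
    then have "card S + card T \<le> card ?K"
      using card_Un_disjoint[of S T] finS card_mono[OF fin, of "S \<union> T"] SK TK
      by (simp add: T_def)
    then show False using lt \<open>card T = card S\<close> by simp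
  qed
  then show ?thesis by (auto simp: S_def T_def)
qed

section \<open>Annihilators of singular matrices\<close>

definition mat2_kernel ::
    "('a, 'm) ring_scheme \<Rightarrow> 'a \<times> 'a \<times> 'a \<times> 'a \<Rightarrow> ('a \<times> 'a) set" where
  "mat2_kernel R = (\<lambda>(a, b, c, d). {(s, t) \<in> carrier R \<times> carrier R.
     a \<otimes>\<^bsub>R\<^esub> s \<oplus>\<^bsub>R\<^esub> b \<otimes>\<^bsub>R\<^esub> t = \<zero>\<^bsub>R\<^esub> \<and> c \<otimes>\<^bsub>R\<^esub> s \<oplus>\<^bsub>R\<^esub> d \<otimes>\<^bsub>R\<^esub> t = \<zero>\<^bsub>R\<^esub>})"

definition mat2_transpose :: "'a \<times> 'a \<times> 'a \<times> 'a \<Rightarrow> 'a \<times> 'a \<times> 'a \<times> 'a" where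
  "mat2_transpose = (\<lambda>(a, b, c, d). (a, c, b, d))"

definition singular_mat2 :: "('a, 'm) ring_scheme \<Rightarrow> ('a \<times> 'a \<times> 'a \<times> 'a) set" where
  "singular_mat2 R = {(a, b, c, d) \<in> carrier (mat2_ring R). a \<otimes>\<^bsub>R\<^esub> d = b \<otimes>\<^bsub>R\<^esub> c}"

context field begin

lemma ex_quotient:
  assumes "a \<in> carrier R" "b \<in> carrier R" "a \<noteq> \<zero>"
  shows "\<exists>l\<in>carrier R. b = a \<otimes> l"
proof
  have "a \<in> Units R" using assms by (simp add: field_Units)
  then show "inv a \<otimes> b \<in> carrier R" "b = a \<otimes> (inv a \<otimes> b)"
    using assms by (simp_all add: m_assoc[symmetric])
qed

lemma linear_form_kernel:
  assumes r: "r1 \<in> carrier R" "r2 \<in> carrier R" "(r1, r2) \<noteq> (\<zero>, \<zero>)"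
  shows "{(s, t) \<in> carrier R \<times> carrier R. r1 \<otimes> s \<oplus> r2 \<otimes> t = \<zero>} =
    (\<lambda>l. (l \<otimes> \<ominus> r2, l \<otimes> r1)) ` carrier R"
proof -
  have "\<exists>l\<in>carrier R. s = l \<otimes> \<ominus> r2 \<and> t = l \<otimes> r1"
    if st: "s \<in> carrier R" "t \<in> carrier R" "r1 \<otimes> s \<oplus> r2 \<otimes> t = \<zero>" for s t
  proof (cases "r1 = \<zero>")
    case False
    then obtain l where l: "l \<in> carrier R" "t = r1 \<otimes> l" using ex_quotient r st by blast
    have "r1 \<otimes> s = \<ominus> (r2 \<otimes> t)" using st r by (metis m_closed minus_equality)
    also have "\<dots> = r1 \<otimes> (l \<otimes> \<ominus> r2)" using l r by (simp add: r_minus m_ac)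
    finally have "s = l \<otimes> \<ominus> r2" using l r st False by (simp add: m_lcancel)
    then show ?thesis using l r by (auto simp: m_comm)
  next
    case True
    then have r2: "r2 \<noteq> \<zero>" and "t = \<zero>" using r st integral by auto
    moreover obtain l where "l \<in> carrier R" "s = \<ominus> r2 \<otimes> l"
      using ex_quotient[of "\<ominus> r2" s] r st r2 by auto
    ultimately show ?thesis using True r by (auto simp: m_comm)
  qed
  moreover have "r1 \<otimes> (l \<otimes> \<ominus> r2) \<oplus> r2 \<otimes> (l \<otimes> r1) = \<zero>" if "l \<in> carrier R" for l
    using that r by (simp add: ring_normalize)
  ultimately show ?thesis using r by auto
qed

text \<open>The rows of a singular matrix are proportional, so the kernel is cut out by the linear
  form of a single nonzero row.\<close>

lemma kernel_of_singular_is_line: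
  assumes x: "x \<in> singular_mat2 R" "x \<noteq> \<zero>\<^bsub>mat2_ring R\<^esub>"
  obtains k1 k2 where "k1 \<in> carrier R" "k2 \<in> carrier R" "(k1, k2) \<noteq> (\<zero>, \<zero>)"
    "mat2_kernel R x = (\<lambda>l. (l \<otimes> k1, l \<otimes> k2)) ` carrier R"
proof -
  obtain a b c d where x_eq: "x = (a, b, c, d)" and
    K: "a \<in> carrier R" "b \<in> carrier R" "c \<in> carrier R" "d \<in> carrier R" and det: "a \<otimes> d = b \<otimes> c"
    using x(1) by (auto simp: singular_mat2_def mat2_ring_def)
  have "\<exists>r1\<in>carrier R. \<exists>r2\<in>carrier R. (r1, r2) \<noteq> (\<zero>, \<zero>) \<and>
    mat2_kernel R x = {(s, t) \<in> carrier R \<times> carrier R. r1 \<otimes> s \<oplus> r2 \<otimes> t = \<zero>}"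
  proof (cases "(a, b) = (\<zero>, \<zero>)")
    case True
    then have "(c, d) \<noteq> (\<zero>, \<zero>)" using x(2) by (auto simp: x_eq mat2_ring_def)
    moreover have "mat2_kernel R x = {(s, t) \<in> carrier R \<times> carrier R. c \<otimes> s \<oplus> d \<otimes> t = \<zero>}"
      using True by (auto simp: x_eq mat2_kernel_def)
    ultimately show ?thesis using K by blast
  next
    case False
    \<comment> \<open>Multiplied by either entry of the first row, the second equation becomes a multiple of
      the first one, because \<open>ad = bc\<close>.\<close>
    have "c \<otimes> s \<oplus> d \<otimes> t = \<zero>"
      if st: "s \<in> carrier R" "t \<in> carrier R" "a \<otimes> s \<oplus> b \<otimes> t = \<zero>" for s t
    proof -
      have "a \<otimes> (c \<otimes> s \<oplus> d \<otimes> t) = c \<otimes> (a \<otimes> s) \<oplus> (a \<otimes> d) \<otimes> t"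
        using K st(1,2) by (simp add: ring_normalize)
      also have "\<dots> = c \<otimes> (a \<otimes> s \<oplus> b \<otimes> t)"
        unfolding det using K st(1,2) by (simp add: ring_normalize)
      finally have 1: "a \<otimes> (c \<otimes> s \<oplus> d \<otimes> t) = \<zero>" using K st(3) by simp
      have "b \<otimes> (c \<otimes> s \<oplus> d \<otimes> t) = (b \<otimes> c) \<otimes> s \<oplus> d \<otimes> (b \<otimes> t)"
        using K st(1,2) by (simp add: ring_normalize)
      also have "\<dots> = d \<otimes> (a \<otimes> s \<oplus> b \<otimes> t)"
        unfolding det[symmetric] using K st(1,2) by (simp add: ring_normalize)
      finally have "b \<otimes> (c \<otimes> s \<oplus> d \<otimes> t) = \<zero>" using K st(3) by simp
      then show ?thesis using 1 False K st(1,2) integral by auto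
    qed
    then have "mat2_kernel R x = {(s, t) \<in> carrier R \<times> carrier R. a \<otimes> s \<oplus> b \<otimes> t = \<zero>}"
      by (auto simp: x_eq mat2_kernel_def)
    then show ?thesis using K False by blast
  qed
  then obtain r1 r2 where r: "r1 \<in> carrier R" "r2 \<in> carrier R" "(r1, r2) \<noteq> (\<zero>, \<zero>)"
    and ker: "mat2_kernel R x = {(s, t) \<in> carrier R \<times> carrier R. r1 \<otimes> s \<oplus> r2 \<otimes> t = \<zero>}"
    by (elim bexE conjE) (rule that)
  have "(\<ominus> r2, r1) \<noteq> (\<zero>, \<zero>)"
    using r by auto
  then show thesis
    by (intro that[of "\<ominus> r2" r1] trans[OF ker linear_form_kernel[OF r]]) (use r in auto)
qed

lemma inj_on_line:
  assumes "k1 \<in> carrier R" "k2 \<in> carrier R" "(k1, k2) \<noteq> (\<zero>, \<zero>)"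
  shows "inj_on (\<lambda>l. (l \<otimes> k1, l \<otimes> k2)) (carrier R)"
  using assms by (auto simp: inj_on_def m_rcancel)

lemma card_kernel_of_singular:
  assumes "x \<in> singular_mat2 R" "x \<noteq> \<zero>\<^bsub>mat2_ring R\<^esub>"
  shows "card (mat2_kernel R x) = card (carrier R)"
proof (rule kernel_of_singular_is_line[OF assms])
  fix k1 k2
  assume k: "k1 \<in> carrier R" "k2 \<in> carrier R" "(k1, k2) \<noteq> (\<zero>, \<zero>)"
    and ker: "mat2_kernel R x = (\<lambda>l. (l \<otimes> k1, l \<otimes> k2)) ` carrier R"
  show ?thesis unfolding ker by (rule card_image[OF inj_on_line[OF k]])
qed

lemma transpose_singular:
  assumes "x \<in> singular_mat2 R" "x \<noteq> \<zero>\<^bsub>mat2_ring R\<^esub>"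
  shows "mat2_transpose x \<in> singular_mat2 R" "mat2_transpose x \<noteq> \<zero>\<^bsub>mat2_ring R\<^esub>"
  using assms by (auto simp: singular_mat2_def mat2_transpose_def mat2_ring_def m_comm)

lemma transpose_mult:
  assumes "x \<in> carrier (mat2_ring R)" "y \<in> carrier (mat2_ring R)"
  shows "mat2_transpose (x \<otimes>\<^bsub>mat2_ring R\<^esub> y) = mat2_transpose y \<otimes>\<^bsub>mat2_ring R\<^esub> mat2_transpose x"
  using assms by (auto simp: mat2_ring_def mat2_transpose_def m_comm a_comm)

text \<open>\<open>xy = 0\<close> says that both columns of \<open>y\<close> lie in the kernel of \<open>x\<close>, which has as many
  elements as the field.\<close>

lemma card_right_annihilator:
  assumes "x \<in> singular_mat2 R" "x \<noteq> \<zero>\<^bsub>mat2_ring R\<^esub>"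
  shows "card {y \<in> carrier (mat2_ring R). x \<otimes>\<^bsub>mat2_ring R\<^esub> y = \<zero>\<^bsub>mat2_ring R\<^esub>} = card (carrier R) ^ 2"
    (is "card ?A = _")
proof -
  have "bij_betw (\<lambda>(e, f, g, h). ((e, g), (f, h))) ?A (mat2_kernel R x \<times> mat2_kernel R x)"
    by (rule bij_betwI[where g = "\<lambda>((e, g), (f, h)). (e, f, g, h)"])
       (auto simp: mat2_ring_def mat2_kernel_def split: prod.splits)
  then have "card ?A = card (mat2_kernel R x \<times> mat2_kernel R x)" by (rule bij_betw_same_card)
  then show ?thesis
    by (simp add: card_cartesian_product card_kernel_of_singular[OF assms] power2_eq_square)
qed

lemma card_left_annihilator:
  assumes x: "x \<in> singular_mat2 R" "x \<noteq> \<zero>\<^bsub>mat2_ring R\<^esub>"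
  shows "card {y \<in> carrier (mat2_ring R). y \<otimes>\<^bsub>mat2_ring R\<^esub> x = \<zero>\<^bsub>mat2_ring R\<^esub>} = card (carrier R) ^ 2"
    (is "card ?A = _")
proof -
  let ?B = "{y \<in> carrier (mat2_ring R). mat2_transpose x \<otimes>\<^bsub>mat2_ring R\<^esub> y = \<zero>\<^bsub>mat2_ring R\<^esub>}"
  have invol: "mat2_transpose (mat2_transpose y) = y" for y :: "'a \<times> 'a \<times> 'a \<times> 'a"
    by (simp add: mat2_transpose_def split: prod.splits)
  have zero: "mat2_transpose y = \<zero>\<^bsub>mat2_ring R\<^esub> \<longleftrightarrow> y = \<zero>\<^bsub>mat2_ring R\<^esub>" for y
    by (auto simp: mat2_transpose_def mat2_ring_def split: prod.splits)
  have closed: "mat2_transpose y \<in> carrier (mat2_ring R)" if "y \<in> carrier (mat2_ring R)" for y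
    using that by (auto simp: mat2_transpose_def mat2_ring_def)
  have xc: "x \<in> carrier (mat2_ring R)" using x by (auto simp: singular_mat2_def)
  have swap: "y \<otimes>\<^bsub>mat2_ring R\<^esub> x = \<zero>\<^bsub>mat2_ring R\<^esub> \<longleftrightarrow>
      mat2_transpose x \<otimes>\<^bsub>mat2_ring R\<^esub> mat2_transpose y = \<zero>\<^bsub>mat2_ring R\<^esub>"
    if "y \<in> carrier (mat2_ring R)" for y
    unfolding transpose_mult[OF that xc, symmetric] zero by (rule refl)
  have "bij_betw mat2_transpose ?A ?B"
  proof (rule bij_betwI[where g = mat2_transpose])
    show "mat2_transpose \<in> ?A \<rightarrow> ?B"
    proof (rule funcsetI, elim CollectE conjE, intro CollectI conjI)
      fix y assume y: "y \<in> carrier (mat2_ring R)" "y \<otimes>\<^bsub>mat2_ring R\<^esub> x = \<zero>\<^bsub>mat2_ring R\<^esub>"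
      show "mat2_transpose y \<in> carrier (mat2_ring R)" by (rule closed[OF y(1)])
      show "mat2_transpose x \<otimes>\<^bsub>mat2_ring R\<^esub> mat2_transpose y = \<zero>\<^bsub>mat2_ring R\<^esub>"
        by (rule iffD1[OF swap[OF y(1)] y(2)])
    qed
    show "mat2_transpose \<in> ?B \<rightarrow> ?A"
    proof (rule funcsetI, elim CollectE conjE, intro CollectI conjI)
      fix y assume y: "y \<in> carrier (mat2_ring R)"
        "mat2_transpose x \<otimes>\<^bsub>mat2_ring R\<^esub> y = \<zero>\<^bsub>mat2_ring R\<^esub>"
      show "mat2_transpose y \<in> carrier (mat2_ring R)" by (rule closed[OF y(1)])
      show "mat2_transpose y \<otimes>\<^bsub>mat2_ring R\<^esub> x = \<zero>\<^bsub>mat2_ring R\<^esub>"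
        using y(2) by (simp only: swap[OF closed[OF y(1)]] invol)
    qed
  qed (simp_all only: invol)
  then have "card ?A = card ?B" by (rule bij_betw_same_card)
  then show ?thesis using card_right_annihilator[OF transpose_singular[OF x]] by simp
qed

text \<open>Let \<open>k\<close> span the kernel of \<open>x\<close>. The condition \<open>xy = 0\<close> makes the columns of \<open>y\<close>
  multiples \<open>lk\<close>, \<open>mk\<close> of \<open>k\<close>; then \<open>yx\<close> is the product of the column \<open>k\<close> and the row
  \<open>(l, m) x\<close>, which vanishes iff \<open>(l, m)\<close> lies in the kernel of the transpose of \<open>x\<close>.\<close>

lemma card_two_sided_annihilator:
  assumes x: "x \<in> singular_mat2 R" "x \<noteq> \<zero>\<^bsub>mat2_ring R\<^esub>"
  shows "card {y \<in> carrier (mat2_ring R). x \<otimes>\<^bsub>mat2_ring R\<^esub> y = \<zero>\<^bsub>mat2_ring R\<^esub> \<and>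
    y \<otimes>\<^bsub>mat2_ring R\<^esub> x = \<zero>\<^bsub>mat2_ring R\<^esub>} = card (carrier R)" (is "card ?A = _")
proof -
  obtain k1 k2 where k: "k1 \<in> carrier R" "k2 \<in> carrier R" "(k1, k2) \<noteq> (\<zero>, \<zero>)"
    and ker: "mat2_kernel R x = (\<lambda>l. (l \<otimes> k1, l \<otimes> k2)) ` carrier R"
    using kernel_of_singular_is_line[OF x] .
  obtain a b c d where x_eq: "x = (a, b, c, d)" and
    K: "a \<in> carrier R" "b \<in> carrier R" "c \<in> carrier R" "d \<in> carrier R"
    using x(1) by (auto simp: singular_mat2_def mat2_ring_def)
  let ?f = "\<lambda>(l, m). (l \<otimes> k1, m \<otimes> k1, l \<otimes> k2, m \<otimes> k2)"
  have row: "y \<otimes>\<^bsub>mat2_ring R\<^esub> x = \<zero>\<^bsub>mat2_ring R\<^esub> \<longleftrightarrow> (l, m) \<in> mat2_kernel R (mat2_transpose x)"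
    if lm: "l \<in> carrier R" "m \<in> carrier R" "y = ?f (l, m)" for l m y
  proof -
    have f: "(l \<otimes> k) \<otimes> e \<oplus> (m \<otimes> k) \<otimes> g = k \<otimes> (e \<otimes> l \<oplus> g \<otimes> m)"
      if "k \<in> carrier R" "e \<in> carrier R" "g \<in> carrier R" for k e g
      using that lm(1,2) by (simp add: ring_normalize)
    have z: "k \<otimes> w = \<zero> \<longleftrightarrow> k = \<zero> \<or> w = \<zero>" if "k \<in> carrier R" "w \<in> carrier R" for k w
      using that integral by auto
    show ?thesis
      using lm k K
      by (auto simp: x_eq mat2_ring_def mat2_kernel_def mat2_transpose_def f z simp del: l_distr r_distr)
  qed
  have "?A = ?f ` mat2_kernel R (mat2_transpose x)"
  proof (intro equalityI subsetI)
    fix y assume y: "y \<in> ?A"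
    obtain e f g h where y_eq: "y = (e, f, g, h)" by (metis surj_pair)
    have "(e, g) \<in> mat2_kernel R x" "(f, h) \<in> mat2_kernel R x"
      using y by (auto simp: y_eq x_eq mat2_ring_def mat2_kernel_def)
    then obtain l m where lm: "l \<in> carrier R" "m \<in> carrier R" "y = ?f (l, m)"
      unfolding ker y_eq by auto
    then show "y \<in> ?f ` mat2_kernel R (mat2_transpose x)" using row[OF lm] y by blast
  next
    fix y assume "y \<in> ?f ` mat2_kernel R (mat2_transpose x)"
    then obtain l m where lm: "(l, m) \<in> mat2_kernel R (mat2_transpose x)" "y = ?f (l, m)" by auto
    then have lm': "l \<in> carrier R" "m \<in> carrier R" by (auto simp: mat2_kernel_def mat2_transpose_def x_eq)
    then have "(l \<otimes> k1, l \<otimes> k2) \<in> mat2_kernel R x" "(m \<otimes> k1, m \<otimes> k2) \<in> mat2_kernel R x"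
      unfolding ker by auto
    then have "y \<in> carrier (mat2_ring R) \<and> x \<otimes>\<^bsub>mat2_ring R\<^esub> y = \<zero>\<^bsub>mat2_ring R\<^esub>"
      by (auto simp: lm(2) x_eq mat2_ring_def mat2_kernel_def)
    then show "y \<in> ?A" using row[OF lm' lm(2)] lm(1) by auto
  qed
  moreover have "inj_on ?f (mat2_kernel R (mat2_transpose x))"
    using inj_on_line[OF k]
    by (fastforce simp: inj_on_def mat2_kernel_def mat2_transpose_def x_eq)
  ultimately show ?thesis
    using card_kernel_of_singular[OF transpose_singular[OF x]] by (simp add: card_image)
qed

end

section \<open>Counting edges of zero divisor graphs\<close>

lemma handshake:
  fixes adj :: "'v \<Rightarrow> 'v \<Rightarrow> bool"
  assumes fin: "finite V" and sym: "\<And>x y. adj x y \<Longrightarrow> adj y x"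
  shows "2 * card {{x, y} | x y. x \<in> V \<and> y \<in> V \<and> x \<noteq> y \<and> adj x y} =
    (\<Sum>x\<in>V. card {y \<in> V. x \<noteq> y \<and> adj x y})"
proof -
  let ?P = "SIGMA x:V. {y \<in> V. x \<noteq> y \<and> adj x y}"
  let ?f = "\<lambda>(x, y). {x, y}"
  have finP: "finite ?P" using fin by (rule finite_SigmaI) (use fin in auto)
  have fibre: "card {z \<in> ?P. ?f z = e} = 2" if e: "e \<in> ?f ` ?P" for e
  proof -
    obtain x y where xy: "(x, y) \<in> ?P" and e_eq: "e = {x, y}" using e by auto
    have "{z \<in> ?P. ?f z = e} = {(x, y), (y, x)}"
      using xy sym by (auto simp: e_eq doubleton_eq_iff)
    then show ?thesis using xy by auto
  qed
  have "{{x, y} | x y. x \<in> V \<and> y \<in> V \<and> x \<noteq> y \<and> adj x y} = ?f ` ?P" by force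
  then have "2 * card {{x, y} | x y. x \<in> V \<and> y \<in> V \<and> x \<noteq> y \<and> adj x y} =
      (\<Sum>e\<in>?f ` ?P. card {z \<in> ?P. ?f z = e})"
    using fibre by simp
  also have "\<dots> = card ?P"
    using sum.group[where g = ?f and h = "\<lambda>_. 1::nat", OF finP finite_imageI[OF finP] subset_refl]
    by simp
  also have "\<dots> = (\<Sum>x\<in>V. card {y \<in> V. x \<noteq> y \<and> adj x y})"
    using fin by simp
  finally show ?thesis .
qed

lemma zero_divisor_graph_edges_eq:
  "graph_edges (zero_divisor_graph M) =
    {{x, y} | x y. x \<in> nonzero_zero_divisors M \<and> y \<in> nonzero_zero_divisors M \<and> x \<noteq> y \<and>
       (x \<otimes>\<^bsub>M\<^esub> y = \<zero>\<^bsub>M\<^esub> \<or> y \<otimes>\<^bsub>M\<^esub> x = \<zero>\<^bsub>M\<^esub>)}"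
  by (simp add: graph_edges_def zero_divisor_graph_def)

text \<open>The zero divisor graph depends on the multiplication and the zero element alone, so a
  bijection that respects these two carries edges to edges.\<close>

lemma card_zero_divisor_graph_edges_transfer:
  assumes bij: "bij_betw h (carrier M) (carrier N)"
    and mult: "\<And>x y. x \<in> carrier M \<Longrightarrow> y \<in> carrier M \<Longrightarrow> h (x \<otimes>\<^bsub>M\<^esub> y) = h x \<otimes>\<^bsub>N\<^esub> h y"
    and closed: "\<And>x y. x \<in> carrier M \<Longrightarrow> y \<in> carrier M \<Longrightarrow> x \<otimes>\<^bsub>M\<^esub> y \<in> carrier M"
    and zero: "\<zero>\<^bsub>M\<^esub> \<in> carrier M" "h \<zero>\<^bsub>M\<^esub> = \<zero>\<^bsub>N\<^esub>"
  shows "card (graph_edges (zero_divisor_graph M)) = card (graph_edges (zero_divisor_graph N))"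
proof -
  let ?Z = "nonzero_zero_divisors M"
  have inj: "inj_on h (carrier M)" and im: "carrier N = h ` carrier M"
    using bij by (auto simp: bij_betw_def)
  have z: "h x = \<zero>\<^bsub>N\<^esub> \<longleftrightarrow> x = \<zero>\<^bsub>M\<^esub>" if "x \<in> carrier M" for x
    using inj_on_eq_iff[OF inj that zero(1)] zero(2) by simp
  have m: "h x \<otimes>\<^bsub>N\<^esub> h y = \<zero>\<^bsub>N\<^esub> \<longleftrightarrow> x \<otimes>\<^bsub>M\<^esub> y = \<zero>\<^bsub>M\<^esub>" if "x \<in> carrier M" "y \<in> carrier M" for x y
    using z[OF closed[OF that]] mult[OF that] by simp
  have nz: "carrier N - {\<zero>\<^bsub>N\<^esub>} = h ` (carrier M - {\<zero>\<^bsub>M\<^esub>})" unfolding im using z by auto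
  have ZM: "?Z \<subseteq> carrier M" by (auto simp: nonzero_zero_divisors_def)
  have ZN: "nonzero_zero_divisors N = h ` ?Z"
    unfolding nonzero_zero_divisors_def nz using m by auto
  have "graph_edges (zero_divisor_graph N) = (`) h ` graph_edges (zero_divisor_graph M)"
  proof (intro equalityI subsetI)
    fix e assume "e \<in> graph_edges (zero_divisor_graph N)"
    then obtain x y where "x \<in> ?Z" "y \<in> ?Z" "h x \<noteq> h y" "e = h ` {x, y}"
      "h x \<otimes>\<^bsub>N\<^esub> h y = \<zero>\<^bsub>N\<^esub> \<or> h y \<otimes>\<^bsub>N\<^esub> h x = \<zero>\<^bsub>N\<^esub>"
      unfolding zero_divisor_graph_edges_eq ZN by auto
    then show "e \<in> (`) h ` graph_edges (zero_divisor_graph M)"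
      unfolding zero_divisor_graph_edges_eq
      by (intro image_eqI[of _ _ "{x, y}"]) (use m ZM in blast)+
  next
    fix e assume "e \<in> (`) h ` graph_edges (zero_divisor_graph M)"
    then obtain x y where xy: "x \<in> ?Z" "y \<in> ?Z" "x \<noteq> y" "e = h ` {x, y}"
      "x \<otimes>\<^bsub>M\<^esub> y = \<zero>\<^bsub>M\<^esub> \<or> y \<otimes>\<^bsub>M\<^esub> x = \<zero>\<^bsub>M\<^esub>"
      unfolding zero_divisor_graph_edges_eq by auto
    then have "h x \<noteq> h y" "h x \<otimes>\<^bsub>N\<^esub> h y = \<zero>\<^bsub>N\<^esub> \<or> h y \<otimes>\<^bsub>N\<^esub> h x = \<zero>\<^bsub>N\<^esub>"
      using m ZM inj by (auto dest: inj_onD)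
    then show "e \<in> graph_edges (zero_divisor_graph N)"
      unfolding zero_divisor_graph_edges_eq ZN using xy by auto
  qed
  moreover have "inj_on ((`) h) (graph_edges (zero_divisor_graph M))"
  proof (rule inj_on_subset)
    show "inj_on ((`) h) (Pow (carrier M))" by (rule inj_on_image_Pow[OF inj])
    show "graph_edges (zero_divisor_graph M) \<subseteq> Pow (carrier M)"
      unfolding zero_divisor_graph_edges_eq using ZM by auto
  qed
  ultimately show ?thesis by (simp add: card_image)
qed

section \<open>Counting singular and square-zero matrices\<close>

context field begin

text \<open>Cramer's rule: multiplied by the determinant, \<open>s\<close> and \<open>t\<close> are combinations of the two
  left-hand sides.\<close>

lemma nonsingular_injective:
  assumes K: "a \<in> carrier R" "b \<in> carrier R" "c \<in> carrier R" "d \<in> carrier R"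
    "s \<in> carrier R" "t \<in> carrier R"
    and "a \<otimes> d \<noteq> b \<otimes> c" and 0: "a \<otimes> s \<oplus> b \<otimes> t = \<zero>" "c \<otimes> s \<oplus> d \<otimes> t = \<zero>"
  shows "s = \<zero> \<and> t = \<zero>"
proof -
  have D: "a \<otimes> d \<ominus> b \<otimes> c \<noteq> \<zero>" using assms by (simp add: minus_move)
  have "(a \<otimes> d \<ominus> b \<otimes> c) \<otimes> s = d \<otimes> (a \<otimes> s \<oplus> b \<otimes> t) \<ominus> b \<otimes> (c \<otimes> s \<oplus> d \<otimes> t)"
    "(a \<otimes> d \<ominus> b \<otimes> c) \<otimes> t = a \<otimes> (c \<otimes> s \<oplus> d \<otimes> t) \<ominus> c \<otimes> (a \<otimes> s \<oplus> b \<otimes> t)"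
    using K by (simp_all add: ring_normalize)
  then have "(a \<otimes> d \<ominus> b \<otimes> c) \<otimes> s = \<zero>" "(a \<otimes> d \<ominus> b \<otimes> c) \<otimes> t = \<zero>"
    unfolding 0 using K by (simp_all add: minus_eq)
  then show ?thesis using D K integral[of "a \<otimes> d \<ominus> b \<otimes> c"] by auto
qed

lemma card_field_gt_1:
  assumes "finite (carrier R)"
  shows "card (carrier R) > 1"
proof -
  have "card {\<zero>, \<one>} \<le> card (carrier R)" using assms by (intro card_mono) auto
  then show ?thesis by simp
qed

text \<open>A singular matrix \<open>x\<close> has \<open>q\<^sup>2 > 1\<close> right annihilators, hence a nonzero one. If \<open>x\<close> has
  nonzero determinant, then \<open>xy = 0\<close> kills the columns of \<open>y\<close> and \<open>yx = 0\<close> its rows.\<close>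

lemma zero_divisors_mat2_ring:
  assumes fin: "finite (carrier R)"
  shows "nonzero_zero_divisors (mat2_ring R) = singular_mat2 R - {\<zero>\<^bsub>mat2_ring R\<^esub>}"
proof (intro equalityI subsetI)
  fix x assume x: "x \<in> singular_mat2 R - {\<zero>\<^bsub>mat2_ring R\<^esub>}"
  let ?A = "{y \<in> carrier (mat2_ring R). x \<otimes>\<^bsub>mat2_ring R\<^esub> y = \<zero>\<^bsub>mat2_ring R\<^esub>}"
  have "1 < card (carrier R) ^ 2"
    using one_less_power[OF card_field_gt_1[OF fin], of 2] by simp
  then have "1 < card ?A" using card_right_annihilator[of x] x by simp
  then have "\<not> ?A \<subseteq> {\<zero>\<^bsub>mat2_ring R\<^esub>}"
    using card_mono[of "{\<zero>\<^bsub>mat2_ring R\<^esub>}" ?A] by auto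
  then show "x \<in> nonzero_zero_divisors (mat2_ring R)"
    using x by (auto simp: nonzero_zero_divisors_def singular_mat2_def)
next
  fix x assume "x \<in> nonzero_zero_divisors (mat2_ring R)"
  then obtain y where xy: "x \<in> carrier (mat2_ring R)" "y \<in> carrier (mat2_ring R)"
    "x \<noteq> \<zero>\<^bsub>mat2_ring R\<^esub>" "y \<noteq> \<zero>\<^bsub>mat2_ring R\<^esub>"
    "x \<otimes>\<^bsub>mat2_ring R\<^esub> y = \<zero>\<^bsub>mat2_ring R\<^esub> \<or> y \<otimes>\<^bsub>mat2_ring R\<^esub> x = \<zero>\<^bsub>mat2_ring R\<^esub>"
    by (auto simp: nonzero_zero_divisors_def)
  obtain a b c d e f g h where x_eq: "x = (a, b, c, d)" and y_eq: "y = (e, f, g, h)" and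
    K: "a \<in> carrier R" "b \<in> carrier R" "c \<in> carrier R" "d \<in> carrier R"
       "e \<in> carrier R" "f \<in> carrier R" "g \<in> carrier R" "h \<in> carrier R"
    using xy(1,2) by (auto simp: mat2_ring_def)
  have "a \<otimes> d = b \<otimes> c"
  proof (rule ccontr)
    assume D: "a \<otimes> d \<noteq> b \<otimes> c"
    then have D': "a \<otimes> d \<noteq> c \<otimes> b" using K by (simp add: m_comm)
    from xy(5) show False
    proof
      assume "x \<otimes>\<^bsub>mat2_ring R\<^esub> y = \<zero>\<^bsub>mat2_ring R\<^esub>"
      then have "e = \<zero> \<and> g = \<zero>" "f = \<zero> \<and> h = \<zero>"
        using nonsingular_injective[of a b c d e g] nonsingular_injective[of a b c d f h] K D
        by (simp_all add: x_eq y_eq mat2_ring_def)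
      then show False using xy(4) by (simp add: y_eq mat2_ring_def)
    next
      assume "y \<otimes>\<^bsub>mat2_ring R\<^esub> x = \<zero>\<^bsub>mat2_ring R\<^esub>"
      then have "e = \<zero> \<and> f = \<zero>" "g = \<zero> \<and> h = \<zero>"
        using nonsingular_injective[of a c b d e f] nonsingular_injective[of a c b d g h] K D'
        by (simp_all add: x_eq y_eq mat2_ring_def m_comm)
      then show False using xy(4) by (simp add: y_eq mat2_ring_def)
    qed
  qed
  then show "x \<in> singular_mat2 R - {\<zero>\<^bsub>mat2_ring R\<^esub>}"
    using xy by (auto simp: singular_mat2_def x_eq)
qed

lemma mult_eq_iff:
  assumes "a \<in> carrier R" "a \<noteq> \<zero>" "b \<in> carrier R" "c \<in> carrier R"
  shows "a \<otimes> b = c \<longleftrightarrow> b = inv a \<otimes> c"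
proof -
  have "a \<in> Units R" using assms by (simp add: field_Units)
  then show ?thesis using assms by (auto simp: m_assoc[symmetric])
qed

lemma inv_in_carrier: "a \<in> carrier R \<Longrightarrow> a \<noteq> \<zero> \<Longrightarrow> inv a \<in> carrier R"
  by (simp add: field_Units)

text \<open>The equation \<open>ad = bc\<close> determines \<open>d\<close> if \<open>a \<noteq> 0\<close>, which gives \<open>(q - 1) q\<^sup>2\<close> solutions.
  If \<open>a = 0\<close>, then \<open>d\<close> is free and \<open>b = 0\<close> or \<open>c = 0\<close>, which gives \<open>q\<^sup>2 + (q - 1) q\<close> more.\<close>

lemma card_singular_mat2:
  assumes fin: "finite (carrier R)"
  defines "q \<equiv> card (carrier R)"
  shows "real (card (singular_mat2 R)) = real q ^ 3 + real q ^ 2 - real q"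
proof -
  let ?K = "carrier R" and ?U = "carrier R - {\<zero>}"
  let ?f = "\<lambda>(a, b, c). (a, b, c, inv a \<otimes> (b \<otimes> c))"
  let ?S1 = "?f ` (?U \<times> ?K \<times> ?K)" and ?S2 = "{\<zero>} \<times> {\<zero>} \<times> ?K \<times> ?K" and ?S3 = "{\<zero>} \<times> ?U \<times> {\<zero>} \<times> ?K"
  have U: "real (card ?U) = real q - 1"
    using card_field_gt_1[OF fin] fin by (simp add: q_def card_Diff_singleton of_nat_diff)
  have "(a, b, c, d) \<in> singular_mat2 R \<longleftrightarrow> (a, b, c, d) \<in> ?S1 \<union> ?S2 \<union> ?S3" for a b c d
  proof (cases "a \<in> ?K \<and> b \<in> ?K \<and> c \<in> ?K \<and> d \<in> ?K")
    case True
    then have "a \<otimes> d = b \<otimes> c \<longleftrightarrow> d = inv a \<otimes> (b \<otimes> c)" if "a \<noteq> \<zero>"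
      using mult_eq_iff that by auto
    moreover have "\<zero> = b \<otimes> c \<longleftrightarrow> b = \<zero> \<or> c = \<zero>" using True integral[of b c] by auto
    ultimately show ?thesis
      using True by (cases "a = \<zero>") (auto simp: singular_mat2_def mat2_ring_def image_iff)
  next
    case False
    then show ?thesis by (auto simp: singular_mat2_def mat2_ring_def inv_in_carrier)
  qed
  then have S: "singular_mat2 R = ?S1 \<union> ?S2 \<union> ?S3" by (simp add: set_eq_iff split_paired_all)
  have "inj_on ?f (?U \<times> ?K \<times> ?K)" by (auto simp: inj_on_def)
  then have c1: "card ?S1 = card ?U * q * q" by (simp add: card_image card_cartesian_product q_def)
  have "card (singular_mat2 R) = card ?S1 + card ?S2 + card ?S3"
    unfolding S by (subst card_Un_disjoint, use fin in auto)+
  then have "card (singular_mat2 R) = card ?U * q * q + q * q + card ?U * q"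
    unfolding c1 by (simp add: card_cartesian_product q_def)
  then have "real (card (singular_mat2 R)) =
      real (card ?U) * real q * real q + real q * real q + real (card ?U) * real q"
    by (simp only: of_nat_add of_nat_mult)
  then show ?thesis unfolding U by (simp add: power3_eq_cube power2_eq_square algebra_simps)
qed

text \<open>For \<open>b \<noteq> 0\<close> the first row of \<open>x\<^sup>2 = 0\<close> reads \<open>d = -a\<close>, \<open>c = - a\<^sup>2 / b\<close> and implies the
  second row, which gives \<open>q (q - 1)\<close> matrices. For \<open>b = 0\<close> it leaves \<open>a = d = 0\<close> with \<open>c\<close>
  free, which gives \<open>q\<close> more.\<close>

lemma card_square_zero_mat2:
  assumes fin: "finite (carrier R)"
  shows "card {x \<in> carrier (mat2_ring R). x \<otimes>\<^bsub>mat2_ring R\<^esub> x = \<zero>\<^bsub>mat2_ring R\<^esub>} = card (carrier R) ^ 2"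
    (is "card ?N = _")
proof -
  let ?K = "carrier R" and ?U = "carrier R - {\<zero>}"
  let ?f = "\<lambda>(a, b). (a, b, inv b \<otimes> \<ominus> (a \<otimes> a), \<ominus> a)"
  let ?N1 = "?f ` (?K \<times> ?U)" and ?N2 = "{\<zero>} \<times> {\<zero>} \<times> ?K \<times> {\<zero>}"
  have mem: "(a, b, c, d) \<in> ?N \<longleftrightarrow> (a, b, c, d) \<in> ?N1 \<union> ?N2" for a b c d
  proof (cases "a \<in> ?K \<and> b \<in> ?K \<and> c \<in> ?K \<and> d \<in> ?K")
    case K: True
    show ?thesis
    proof (cases "b = \<zero>")
      case True
      have "z \<otimes> z = \<zero> \<longleftrightarrow> z = \<zero>" if "z \<in> ?K" for z using that integral[of z z] by auto
      then show ?thesis using K True by (auto simp: mat2_ring_def)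
    next
      case False
      have neg: "x = \<ominus> y \<longleftrightarrow> x \<oplus> y = \<zero>" "x = \<ominus> y \<longleftrightarrow> y \<oplus> x = \<zero>" if "x \<in> ?K" "y \<in> ?K" for x y
        using that by (metis a_comm minus_equality l_neg)+
      have eq_d: "a \<otimes> b \<oplus> b \<otimes> d = \<zero> \<longleftrightarrow> d = \<ominus> a"
      proof -
        have "a \<otimes> b \<oplus> b \<otimes> d = b \<otimes> (a \<oplus> d)" using K by (simp add: ring_normalize)
        then show ?thesis using K False integral[of b "a \<oplus> d"] neg(2)[of d a] by auto
      qed
      have eq_c: "a \<otimes> a \<oplus> b \<otimes> c = \<zero> \<longleftrightarrow> c = inv b \<otimes> \<ominus> (a \<otimes> a)"
        using K False neg(2)[of "b \<otimes> c" "a \<otimes> a"] mult_eq_iff[of b c "\<ominus> (a \<otimes> a)"] by auto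
      have rest: "c \<otimes> a \<oplus> d \<otimes> c = \<zero>" "c \<otimes> b \<oplus> d \<otimes> d = \<zero>"
        if "d = \<ominus> a" "a \<otimes> a \<oplus> b \<otimes> c = \<zero>"
      proof -
        show "c \<otimes> a \<oplus> d \<otimes> c = \<zero>" unfolding that(1) using K by (simp add: ring_normalize)
        have "c \<otimes> b \<oplus> d \<otimes> d = a \<otimes> a \<oplus> b \<otimes> c" unfolding that(1) using K by (simp add: ring_normalize)
        then show "c \<otimes> b \<oplus> d \<otimes> d = \<zero>" using that(2) by simp
      qed
      have "(a, b, c, d) \<in> ?N \<longleftrightarrow> a \<otimes> a \<oplus> b \<otimes> c = \<zero> \<and> a \<otimes> b \<oplus> b \<otimes> d = \<zero>"
        using K rest eq_d by (auto simp: mat2_ring_def)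
      also have "\<dots> \<longleftrightarrow> (a, b, c, d) \<in> ?N1 \<union> ?N2"
        unfolding eq_d eq_c using K False by auto
      finally show ?thesis .
    qed
  next
    case False
    then show ?thesis by (auto simp: mat2_ring_def inv_in_carrier)
  qed
  have N: "?N = ?N1 \<union> ?N2"
  proof (rule Set.set_eqI)
    show "x \<in> ?N \<longleftrightarrow> x \<in> ?N1 \<union> ?N2" for x by (cases x) (simp only: mem)
  qed
  have "card ?N = card ?N1 + card ?N2"
    unfolding N by (rule card_Un_disjoint) (use fin in auto)
  also have "inj_on ?f (?K \<times> ?U)" by (auto simp: inj_on_def)
  then have "card ?N1 = card ?K * (card ?K - 1)"
    using fin by (simp add: card_image card_cartesian_product card_Diff_singleton)
  also have "card ?K * (card ?K - 1) + card ?N2 = card ?K ^ 2"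
    using card_field_gt_1[OF fin]
    by (cases "card ?K") (simp_all add: card_cartesian_product power2_eq_square)
  finally show ?thesis .
qed

section \<open>Degrees and the number of edges\<close>

text \<open>The left and the right annihilator of \<open>x\<close> have \<open>q\<^sup>2\<close> elements each and meet in \<open>q\<close>
  elements. From their union, zero is to be removed, and \<open>x\<close> itself if \<open>x\<^sup>2 = 0\<close>.\<close>

lemma degree_zero_divisor_graph_mat2:
  assumes fin: "finite (carrier R)"
  defines "q \<equiv> card (carrier R)"
    and "M \<equiv> mat2_ring R"
  assumes x: "x \<in> nonzero_zero_divisors M"
  shows "real (card {y \<in> nonzero_zero_divisors M. x \<noteq> y \<and> (x \<otimes>\<^bsub>M\<^esub> y = \<zero>\<^bsub>M\<^esub> \<or> y \<otimes>\<^bsub>M\<^esub> x = \<zero>\<^bsub>M\<^esub>)}) =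
    2 * real q ^ 2 - real q - 1 - (if x \<otimes>\<^bsub>M\<^esub> x = \<zero>\<^bsub>M\<^esub> then 1 else 0)" (is "real (card ?D) = _")
proof -
  let ?A = "{y \<in> carrier M. x \<otimes>\<^bsub>M\<^esub> y = \<zero>\<^bsub>M\<^esub>}" and ?B = "{y \<in> carrier M. y \<otimes>\<^bsub>M\<^esub> x = \<zero>\<^bsub>M\<^esub>}"
  have xs: "x \<in> singular_mat2 R" "x \<noteq> \<zero>\<^bsub>mat2_ring R\<^esub>"
    using x zero_divisors_mat2_ring[OF fin] by (auto simp: M_def)
  have finM: "finite (carrier M)" using fin by (simp add: M_def mat2_ring_def)
  have xc: "x \<in> carrier M" using x by (simp add: nonzero_zero_divisors_def)
  have zero: "\<zero>\<^bsub>M\<^esub> \<in> carrier M" "x \<otimes>\<^bsub>M\<^esub> \<zero>\<^bsub>M\<^esub> = \<zero>\<^bsub>M\<^esub>"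
    using xc by (auto simp: M_def mat2_ring_def)
  have "?A \<inter> ?B = {y \<in> carrier M. x \<otimes>\<^bsub>M\<^esub> y = \<zero>\<^bsub>M\<^esub> \<and> y \<otimes>\<^bsub>M\<^esub> x = \<zero>\<^bsub>M\<^esub>}" by auto
  then have "card (?A \<inter> ?B) = q"
    using card_two_sided_annihilator[OF xs] by (simp add: M_def q_def)
  then have "card (?A \<union> ?B) + q = q ^ 2 + q ^ 2"
    using card_Un_Int[of ?A ?B] finM card_right_annihilator[OF xs] card_left_annihilator[OF xs]
    by (simp add: M_def q_def)
  then have "real (card (?A \<union> ?B)) + real q = real q ^ 2 + real q ^ 2"
    unfolding of_nat_power[symmetric] of_nat_add[symmetric] by (rule arg_cong)
  then have AB: "real (card (?A \<union> ?B)) = 2 * real q ^ 2 - real q" by simp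
  have D: "?D = (?A \<union> ?B) - {\<zero>\<^bsub>M\<^esub>} - {x}"
    using x unfolding nonzero_zero_divisors_def by auto
  have "card (?A \<union> ?B) = Suc (card (?A \<union> ?B - {\<zero>\<^bsub>M\<^esub>}))"
    using zero finM by (intro card.remove) auto
  then have AB0: "real (card (?A \<union> ?B - {\<zero>\<^bsub>M\<^esub>})) = 2 * real q ^ 2 - real q - 1"
    using AB by simp
  show ?thesis
  proof (cases "x \<otimes>\<^bsub>M\<^esub> x = \<zero>\<^bsub>M\<^esub>")
    case True
    then have "card (?A \<union> ?B - {\<zero>\<^bsub>M\<^esub>}) = Suc (card ?D)"
      unfolding D using xc xs finM by (intro card.remove) (auto simp: M_def)
    then show ?thesis using AB0 True by simp
  next
    case False
    then have "?D = ?A \<union> ?B - {\<zero>\<^bsub>M\<^esub>}" unfolding D by auto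
    then show ?thesis using AB0 False by simp
  qed
qed

text \<open>There are \<open>q\<^sup>3 + q\<^sup>2 - q - 1 = (q\<^sup>2 - 1) (q + 1)\<close> vertices, and \<open>q\<^sup>2 - 1\<close> of them square
  to zero and have degree one less than the others.\<close>

lemma card_edges_mat2_ring:
  assumes fin: "finite (carrier R)"
  defines "q \<equiv> card (carrier R)"
  shows "real (card (graph_edges (zero_divisor_graph (mat2_ring R)))) =
    (real q ^ 2 - 1) * (2 * real q ^ 3 + real q ^ 2 - 2 * real q - 2) / 2"
proof -
  define M where "M = mat2_ring R"
  let ?Z = "nonzero_zero_divisors M" and ?E = "graph_edges (zero_divisor_graph M)"
  let ?N = "{x \<in> carrier M. x \<otimes>\<^bsub>M\<^esub> x = \<zero>\<^bsub>M\<^esub>}"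
  have finM: "finite (carrier M)" using fin by (simp add: M_def mat2_ring_def)
  have finZ: "finite ?Z" by (rule finite_subset[OF _ finM]) (auto simp: nonzero_zero_divisors_def)
  have zero: "\<zero>\<^bsub>M\<^esub> \<in> singular_mat2 R" "\<zero>\<^bsub>M\<^esub> \<in> ?N"
    by (auto simp: singular_mat2_def M_def mat2_ring_def)
  have "card (singular_mat2 R) = Suc (card ?Z)"
    unfolding M_def zero_divisors_mat2_ring[OF fin]
    by (rule card.remove) (use zero finM in \<open>auto simp: M_def singular_mat2_def intro: rev_finite_subset\<close>)
  then have Z: "real (card ?Z) = real q ^ 3 + real q ^ 2 - real q - 1"
    using card_singular_mat2[OF fin] by (simp add: q_def)
  have "?Z \<inter> ?N = ?N - {\<zero>\<^bsub>M\<^esub>}" by (auto simp: nonzero_zero_divisors_def)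
  moreover have "card ?N = Suc (card (?N - {\<zero>\<^bsub>M\<^esub>}))"
    by (rule card.remove) (use zero finM in auto)
  ultimately have N: "real (card (?Z \<inter> ?N)) = real q ^ 2 - 1"
    using card_square_zero_mat2[OF fin] by (simp add: q_def M_def flip: of_nat_power)
  have "2 * card ?E = (\<Sum>x\<in>?Z. card {y \<in> ?Z. x \<noteq> y \<and> (x \<otimes>\<^bsub>M\<^esub> y = \<zero>\<^bsub>M\<^esub> \<or> y \<otimes>\<^bsub>M\<^esub> x = \<zero>\<^bsub>M\<^esub>)})"
    unfolding zero_divisor_graph_edges_eq by (rule handshake[OF finZ]) blast
  then have "2 * real (card ?E) =
      (\<Sum>x\<in>?Z. real (card {y \<in> ?Z. x \<noteq> y \<and> (x \<otimes>\<^bsub>M\<^esub> y = \<zero>\<^bsub>M\<^esub> \<or> y \<otimes>\<^bsub>M\<^esub> x = \<zero>\<^bsub>M\<^esub>)}))"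
    unfolding of_nat_sum[symmetric] by (metis of_nat_mult of_nat_numeral)
  also have "\<dots> = (\<Sum>x\<in>?Z. 2 * real q ^ 2 - real q - 1 - (if x \<in> ?N then 1 else 0))"
    using degree_zero_divisor_graph_mat2[OF fin]
    by (intro sum.cong) (auto simp: M_def q_def nonzero_zero_divisors_def)
  also have "\<dots> = real (card ?Z) * (2 * real q ^ 2 - real q - 1) - real (card (?Z \<inter> ?N))"
    by (simp only: sum_subtractf sum_constant sum.inter_restrict[OF finZ, symmetric]) (simp add: algebra_simps)
  also have "\<dots> = (real q ^ 2 - 1) * (2 * real q ^ 3 + real q ^ 2 - 2 * real q - 2)"
    unfolding Z N by (simp add: algebra_simps power2_eq_square power3_eq_cube)
  finally show ?thesis by (simp add: M_def)
qed

lemma card_edges_quaternion_eq_card_edges_mat2: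
  assumes fin: "finite (carrier R)" and two: "\<one> \<oplus> \<one> \<noteq> \<zero>"
  shows "card (graph_edges (zero_divisor_graph (quaternion_ring R))) =
    card (graph_edges (zero_divisor_graph (mat2_ring R)))"
proof -
  obtain u v where uv: "u \<in> carrier R" "v \<in> carrier R" "v \<otimes> v = \<ominus> \<one> \<ominus> u \<otimes> u"
    using ex_sum_two_squares_eq_minus_one[OF fin] by blast
  let ?h = "quaternion_matrix R u v"
  have carriers: "carrier (mat2_ring R) = carrier (quaternion_ring R)"
    by (simp add: mat2_ring_def quaternion_ring_def)
  have "?h ` carrier (quaternion_ring R) \<subseteq> carrier (quaternion_ring R)"
    using uv(1,2) by (auto simp: quaternion_matrix_def quaternion_ring_def)
  moreover have "finite (carrier (quaternion_ring R))" using fin by (simp add: quaternion_ring_def)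
  ultimately have "bij_betw ?h (carrier (quaternion_ring R)) (carrier (mat2_ring R))"
    using inj_on_quaternion_matrix[OF two uv] unfolding carriers bij_betw_def
    by (simp add: endo_inj_surj)
  then show ?thesis
    using quaternion_matrix_mult[OF uv]
    by (rule card_zero_divisor_graph_edges_transfer)
       (use uv(1,2) in \<open>auto simp: quaternion_matrix_def mat2_ring_def minus_eq, auto simp: quaternion_ring_def minus_eq\<close>)
qed

end

theorem corollary3p5:
  fixes p :: nat
  assumes "prime p" and "odd p"
  shows "real (card (graph_edges (zero_divisor_graph (lipschitz_ring p)))) =
    ((real p)^2 - 1) * (2 * (real p)^3 + (real p)^2 - 2 * real p - 2) / 2"
proof -
  have p: "p > 2" using assms prime_ge_2_nat[of p] by (cases "p = 2") auto
  interpret residues_prime p "residue_ring (int p)"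
    by unfold_locales (use assms in auto)
  have "finite (carrier (residue_ring (int p)))" "card (carrier (residue_ring (int p))) = p"
    by (simp_all add: res_carrier_eq)
  moreover have "\<one>\<^bsub>residue_ring (int p)\<^esub> \<oplus>\<^bsub>residue_ring (int p)\<^esub> \<one>\<^bsub>residue_ring (int p)\<^esub> \<noteq> \<zero>\<^bsub>residue_ring (int p)\<^esub>"
    using p by (simp add: res_one_eq res_zero_eq res_add_eq)
  ultimately show ?thesis
    using field.card_edges_quaternion_eq_card_edges_mat2[OF is_field] field.card_edges_mat2_ring[OF is_field] by (simp add: lipschitz_ring_def)
qed

end
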